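(* Let $\{H_n\}_{n=1}^\infty$ be a Positive Linear Recurrence Sequence with coefficients $c_1,\dots,c_L$, let $K_n$ be the number of summands in the legal decomposition of an integer chosen uniformly at random from $[H_n,H_{n+1})$, and let $\mu_n$ be the mean of $K_n$. Then there exist constants $C>0$, $d$ and $\gamma_1\in(0,1)$ depending only on $L$ and the $c_i$'s such that, as $n\to\infty$, $$\mu_n = Cn+d+o(\gamma_1^n).$$
   Context: A Positive Linear Recurrence Sequence is a sequence $\{H_n\}_{n\ge1}$ of positive integers for which there are non-negative integers $L,c_1,\dots,c_L$ with $L,c_1,c_L$ positive such that $H_1=1$, $H_{n+1}=c_1H_n+c_2H_{n-1}+\cdots+c_nH_1+1$ for $1\le n<L$, and $H_{n+1}=c_1H_n+\cdots+c_LH_{n+1-L}$ for $n\ge L$. When $L=1$ it is assumed that $c_1>1$. A decomposition $\sum_{i=1}^{m} a_iH_{m+1-i}$ of a positive integer (and the integer sequence $\{a_i\}_{i=1}^m$) is called legal if $a_1>0$, the other $a_i\ge0$, and one of the following holds. Condition 1: $m<L$ and $a_i=c_i$ for $1\le i\le m$. Condition 2: there exists $s\in\{1,\dots,L\}$ such that $a_1=c_1,\dots,a_{s-1}=c_{s-1}$ and $a_s<c_s$, $a_{s+1}=\cdots=a_{s+\ell}=0$ for some $\ell\ge0$, and the sequence $\{b_i\}_{i=1}^{m-s-\ell}$ with $b_i=a_{s+\ell+i}$ is legal. The empty sequence (representing $0$) counts as legal. The number of summands of the decomposition is $a_1+\cdots+a_m$. Every positive integer has a unique legal decomposition. *)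

theory Defs
  imports "HOL-Probability.Probability" "HOL-Library.Landau_Symbols"
begin

(* The coefficients c_1, ..., c_L are the list c, so L = length c and c_i = c ! (i - 1).
   Sequences H are indexed from 1; the value H 0 is irrelevant. *)

definition plrs_coeffs :: "nat list \<Rightarrow> bool" where
  "plrs_coeffs c \<longleftrightarrow>
     length c > 0 \<and> c ! 0 > 0 \<and> c ! (length c - 1) > 0 \<and> (length c = 1 \<longrightarrow> c ! 0 > 1)"

definition PLRS :: "nat list \<Rightarrow> (nat \<Rightarrow> nat) \<Rightarrow> bool" where
  "PLRS c H \<longleftrightarrow>
     plrs_coeffs c \<and>
     (\<forall>n\<ge>1. H n > 0) \<and>
     H 1 = 1 \<and>
     (\<forall>n. 1 \<le> n \<and> n < length c \<longrightarrow>
        H (n + 1) = (\<Sum>i=1..n. c ! (i - 1) * H (n + 1 - i)) + 1) \<and>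
     (\<forall>n\<ge>length c. H (n + 1) = (\<Sum>i=1..length c. c ! (i - 1) * H (n + 1 - i)))"

(* A digit sequence a_1, ..., a_m is the list a, most significant digit first: a_i = a ! (i - 1). *)

inductive legal :: "nat list \<Rightarrow> nat list \<Rightarrow> bool" for c where
  empty: "legal c []"
| cond1: "legal c a"
    if "a \<noteq> []" "a ! 0 > 0" "length a < length c"
       "\<forall>i\<in>{1..length a}. a ! (i - 1) = c ! (i - 1)"
| cond2: "legal c a"
    if "a \<noteq> []" "a ! 0 > 0" "s \<in> {1..length c}" "s + l \<le> length a"
       "\<forall>i\<in>{1..<s}. a ! (i - 1) = c ! (i - 1)"
       "a ! (s - 1) < c ! (s - 1)"
       "\<forall>i\<in>{s+1..s+l}. a ! (i - 1) = 0"
       "legal c (drop (s + l) a)"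

definition legal_decomposition :: "nat list \<Rightarrow> (nat \<Rightarrow> nat) \<Rightarrow> nat \<Rightarrow> nat list \<Rightarrow> bool" where
  "legal_decomposition c H N a \<longleftrightarrow>
     legal c a \<and> N = (\<Sum>i=1..length a. a ! (i - 1) * H (length a + 1 - i))"

(* The description operator is justified because, for a PLRS, every positive integer has exactly
   one legal decomposition. *)
definition num_summands :: "nat list \<Rightarrow> (nat \<Rightarrow> nat) \<Rightarrow> nat \<Rightarrow> nat" where
  "num_summands c H N = sum_list (THE a. legal_decomposition c H N a)"

definition mean_summands :: "nat list \<Rightarrow> (nat \<Rightarrow> nat) \<Rightarrow> nat \<Rightarrow> real" where
  "mean_summands c H n =
     measure_pmf.expectation (pmf_of_set {H n..<H (n + 1)}) (\<lambda>N. real (num_summands c H N))"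

end

theory Submission
  imports Defs
begin

text \<open>
  Call a word of length \<open>n\<close> admissible if it is a legal digit sequence with any number of leading
  zeros. Reading a word from its most significant digit, one only has to remember how much of
  \<open>c\<^sub>1, c\<^sub>2, \<dots>\<close> has been matched so far: the next digit either continues the match, or falls below the
  current coefficient and restarts the match at \<open>c\<^sub>1\<close>, or makes the word inadmissible. Splitting words
  by their first digit shows by induction that the value map sends the admissible words of
  length \<open>n\<close> bijectively to \<open>{0..<H (n + 1)}\<close> (\<open>bij_betw_word_value\<close>). Hence legal decompositions exist
  and are unique, and the integers in \<open>[H n, H (n + 1))\<close> correspond to the words of length \<open>n\<close> with
  nonzero first digit. With \<open>a n\<close> the number of admissible words of length \<open>n\<close> and \<open>b n\<close> the
  sum of all their digits, the mean number of summands is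
  \<open>(b (n + 1) - b n) / (a (n + 1) - a n)\<close> at index \<open>n + 1\<close> (\<open>mean_summands_eq\<close>).

  Cutting a word after its first restart gives, for \<open>n \<ge> L\<close>,
  \<open>a n = (\<Sum>i. c\<^sub>i a (n - i))\<close> and \<open>b n = (\<Sum>i. c\<^sub>i b (n - i) + w\<^sub>i a (n - i))\<close>, where \<open>w\<^sub>i \<ge> 0\<close> collects the
  digits of the cut-off blocks of length \<open>i\<close>. Let \<open>0 < x < 1\<close> be the solution of \<open>(\<Sum>i. c\<^sub>i x^i) = 1\<close>.
  After scaling by \<open>x^n\<close> the coefficients \<open>c\<^sub>i x^i\<close> are the weights of an average, and
  averaging has a smoothing effect that replaces a study of complex roots: because the first
  and the last weight are positive, the oscillation over a window of length \<open>L\<close> contracts by a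
  fixed factor every \<open>2L\<close> steps, even when the recurrence is perturbed by a geometrically small
  error (\<open>averaging_recurrence_converges\<close>). Therefore \<open>a n x^n\<close> converges to some \<open>\<eta> > 0\<close>
  geometrically fast. The scaled second recurrence then has an asymptotically constant
  positive inhomogeneity; subtracting \<open>\<kappa> n\<close> for the slope \<open>\<kappa>\<close> that balances it leaves a
  geometrically small error, so \<open>b n x^n = \<kappa> n + \<theta>\<close> up to such an error. Dividing the
  increments of the two expansions gives the claim with \<open>C = \<kappa> / \<eta>\<close>.
\<close>

section \<open>An automaton for legal digit sequences\<close>

text \<open>
  The argument \<open>cs\<close> is the state of the automaton: the suffix of \<open>c\<close> that remains to be matched. A
  word may stop in any state with something left to match, which is Condition 1 of legality or, right after a
  restart, the empty rest in Condition 2; the empty suffix is the rejecting state, since matching all of \<open>c\<close> is not allowed.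
\<close>
fun admissible :: "nat list \<Rightarrow> nat list \<Rightarrow> nat list \<Rightarrow> bool" where
  "admissible c [] a \<longleftrightarrow> False"
| "admissible c (q # qs) [] \<longleftrightarrow> True"
| "admissible c (q # qs) (d # b) \<longleftrightarrow> (d < q \<and> admissible c c b) \<or> (d = q \<and> admissible c qs b)"

lemma admissible_take:
  "m < length cs \<Longrightarrow> admissible c cs (take m cs)"
proof (induction cs arbitrary: m)
  case (Cons q qs)
  then show ?case by (cases m) auto
qed simp

lemma admissible_drop_below:
  "i < length cs \<Longrightarrow> d < cs ! i \<Longrightarrow> admissible c c b \<Longrightarrow> admissible c cs (take i cs @ d # b)"
proof (induction cs arbitrary: i)
  case (Cons q qs)
  then show ?case by (cases i) auto
qed simp

text \<open>
  The two ways in which a word can be admissible mirror the two conditions in the definition of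
  legality: the match is never broken, or \<open>d\<close> is the first digit below its coefficient.
\<close>
lemma admissible_cases:
  assumes "admissible c cs a"
  obtains (match) "length a < length cs" "a = take (length a) cs"
  | (below) i d b where "i < length cs" "d < cs ! i" "a = take i cs @ d # b" "admissible c c b"
  using assms
proof (induction a arbitrary: cs thesis)
  case Nil
  then show ?case by (cases cs) auto
next
  case (Cons x a)
  from Cons.prems(3) obtain q qs where cs: "cs = q # qs" by (cases cs) auto
  show ?case
  proof (cases "x < q \<and> admissible c c a")
    case True
    then show ?thesis using Cons.prems(2)[of 0 x a] cs by auto
  next
    case False
    then have x: "x = q" and a: "admissible c qs a" using Cons.prems(3) cs by auto
    show ?thesis
    proof (rule Cons.IH[OF _ _ a])
      assume "length a < length qs" "a = take (length a) qs"
      then show thesis using Cons.prems(1) cs x by simp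
    next
      fix i d b assume "i < length qs" "d < qs ! i" "a = take i qs @ d # b" "admissible c c b"
      then show thesis using Cons.prems(2)[of "Suc i" d b] cs x by simp
    qed
  qed
qed

text \<open>
  Since \<open>c\<^sub>1 > 0\<close>, a leading zero breaks the match at once and restarts it: the run of zeros in
  Condition 2 is a run of restarts of the automaton.
\<close>
lemma admissible_zeros:
  assumes "c \<noteq> []" "c ! 0 > 0"
  shows "admissible c c (replicate k 0 @ b) \<longleftrightarrow> admissible c c b"
proof (induction k)
  case (Suc k)
  obtain q qs where c: "c = q # qs" "q > 0" using assms by (cases c) auto
  have "admissible c c (0 # replicate k 0 @ b) \<longleftrightarrow> admissible c c (replicate k 0 @ b)"
    using c admissible.simps(3)[of c q qs 0] by auto
  then show ?case using Suc by simp
qed simp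

lemma legal_imp_admissible:
  assumes "c \<noteq> []" "c ! 0 > 0" "legal c a"
  shows "admissible c c a"
  using assms(3)
proof induction
  case empty
  then show ?case using admissible_take[of 0 c c] assms(1) by simp
next
  case (cond1 a)
  have "a = take (length a) c"
  proof (rule nth_equalityI)
    show "length a = length (take (length a) c)" using cond1 by simp
    fix i assume "i < length a"
    then show "a ! i = take (length a) c ! i" using cond1(4)[rule_format, of "Suc i"] by simp
  qed
  then show ?case using admissible_take[of "length a" c c] cond1 by simp
next
  case (cond2 a s l)
  define b where "b = drop (s + l) a"
  have s: "1 \<le> s" "s \<le> length c" using cond2 by auto
  have "a = take (s - 1) c @ a ! (s - 1) # replicate l 0 @ b"
  proof (rule nth_equalityI)
    show "length a = length (take (s - 1) c @ a ! (s - 1) # replicate l 0 @ b)"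
      using cond2 s by (simp add: b_def)
    fix i assume i: "i < length a"
    consider "i < s - 1" | "i = s - 1" | "s \<le> i" "i < s + l" | "s + l \<le> i" by linarith
    then show "a ! i = (take (s - 1) c @ a ! (s - 1) # replicate l 0 @ b) ! i"
    proof cases
      case 1
      then show ?thesis using cond2(5)[rule_format, of "Suc i"] s by (simp add: nth_append)
    next
      case 2
      then show ?thesis using s by (simp add: nth_append)
    next
      case 3
      then have "i - (s - 1) = Suc (i - s)" "i - s < l" "\<not> i < s - 1" using s by linarith+
      then show ?thesis using 3 cond2(7)[rule_format, of "Suc i"] s by (simp add: nth_append)
    next
      case 4
      then have "i - (s - 1) = Suc (i - s)" "\<not> i - s < l" "\<not> i < s - 1" using s by linarith+
      then show ?thesis using 4 s cond2(4) by (simp add: nth_append b_def add.commute)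
    qed
  qed
  moreover have "admissible c c (replicate l 0 @ b)"
    using admissible_zeros[OF assms(1,2)] cond2 by (simp add: b_def)
  ultimately show ?case
    using admissible_drop_below[of "s - 1" c "a ! (s - 1)" c "replicate l 0 @ b"] s cond2 by simp
qed

lemma admissible_imp_legal:
  assumes "c \<noteq> []" "c ! 0 > 0" "admissible c c a" "a \<noteq> [] \<Longrightarrow> hd a > 0"
  shows "legal c a"
  using assms(3,4)
proof (induction "length a" arbitrary: a rule: less_induct)
  case less
  show ?case
  proof (cases "a = []")
    case True
    then show ?thesis by (simp add: legal.empty)
  next
    case False
    then have pos: "a ! 0 > 0" using less by (simp add: hd_conv_nth)
    from less.prems(1) show ?thesis
    proof (cases rule: admissible_cases)
      case match
      then have "a ! (i - 1) = c ! (i - 1)" if "i \<in> {1..length a}" for i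
        using that nth_take[of "i - 1" "length a" c] by fastforce
      then show ?thesis using legal.cond1[of a c] False pos match by blast
    next
      case (below i d b)
      define b' where "b' = dropWhile (\<lambda>x. x = 0) b"
      define l where "l = length (takeWhile (\<lambda>x. x = 0) b)"
      have tw: "takeWhile (\<lambda>x. x = 0) b = replicate l 0"
        unfolding l_def by (metis (full_types) replicate_eqI set_takeWhileD)
      have b: "b = replicate l 0 @ b'"
        unfolding b'_def tw[symmetric] by simp
      have "admissible c c b'"
        using below(4) admissible_zeros[OF assms(1,2)] b by metis
      moreover have "length b' < length a" using below b by simp
      moreover have "b' \<noteq> [] \<Longrightarrow> hd b' > 0"
        unfolding b'_def using hd_dropWhile[of "\<lambda>x. x = 0" b] by simp
      ultimately have "legal c b'" using less.hyps by blast
      moreover have "drop (Suc i + l) a = b'"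
        using below b by simp
      ultimately have leg: "legal c (drop (Suc i + l) a)" by simp
      show ?thesis
      proof (rule legal.cond2[OF False pos _ _ _ _ _ leg])
        show "Suc i \<in> {1..length c}" using below by simp
        show "Suc i + l \<le> length a" using below b by simp
        show "\<forall>j\<in>{1..<Suc i}. a ! (j - 1) = c ! (j - 1)"
          using below by (auto simp: nth_append)
        show "a ! (Suc i - 1) < c ! (Suc i - 1)"
          using below by (simp add: nth_append)
        show "\<forall>j\<in>{Suc i + 1..Suc i + l}. a ! (j - 1) = 0"
        proof
          fix j assume "j \<in> {Suc i + 1..Suc i + l}"
          then have "j - 1 - i = Suc (j - Suc (Suc i))" "j - Suc (Suc i) < l" "\<not> j - 1 < i" by auto
          then show "a ! (j - 1) = 0" using below b by (simp add: nth_append)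
        qed
      qed
    qed
  qed
qed


section \<open>Counting words and adding up their digits\<close>

definition words :: "nat list \<Rightarrow> nat list \<Rightarrow> nat \<Rightarrow> nat list set" where
  "words c cs n = {a. length a = n \<and> admissible c cs a}"

lemma words_Nil: "words c [] n = {}"
  by (simp add: words_def)

lemma words_0: "words c (q # qs) 0 = {[]}"
  by (auto simp: words_def)

lemma words_Suc:
  "words c (q # qs) (Suc n) = (\<Union>d<q. (#) d ` words c c n) \<union> (#) q ` words c qs n"
proof (intro set_eqI iffI)
  fix a assume "a \<in> words c (q # qs) (Suc n)"
  then show "a \<in> (\<Union>d<q. (#) d ` words c c n) \<union> (#) q ` words c qs n"
    by (cases a) (auto simp: words_def)
qed (auto simp: words_def)

lemma finite_words: "finite (words c cs n)"
proof (induction n arbitrary: cs)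
  case 0
  then show ?case by (cases cs) (auto simp: words_Nil words_0)
next
  case (Suc n)
  then show ?case by (cases cs) (auto simp: words_Nil words_Suc)
qed

text \<open>
  The words in \<open>words_Suc\<close> are split by their first digit, so the union is disjoint. Taking \<open>f\<close>
  constant or the digit sum yields the recursions for the number of words and for the total of
  their digits.
\<close>
lemma sum_words_Suc:
  fixes f :: "nat list \<Rightarrow> nat"
  shows "sum f (words c (q # qs) (Suc n)) =
    (\<Sum>d<q. \<Sum>b\<in>words c c n. f (d # b)) + (\<Sum>b\<in>words c qs n. f (q # b))"
proof -
  have "sum f (words c (q # qs) (Suc n)) =
      sum f (\<Union>d<q. (#) d ` words c c n) + sum f ((#) q ` words c qs n)"
    unfolding words_Suc by (rule sum.union_disjoint) (auto simp: finite_words)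
  also have "sum f (\<Union>d<q. (#) d ` words c c n) = (\<Sum>d<q. sum f ((#) d ` words c c n))"
    by (rule sum.UNION_disjoint) (auto simp: finite_words)
  finally show ?thesis by (simp add: sum.reindex)
qed

definition num_words :: "nat list \<Rightarrow> nat list \<Rightarrow> nat \<Rightarrow> nat" where
  "num_words c cs n = card (words c cs n)"

definition total_digit_sum :: "nat list \<Rightarrow> nat list \<Rightarrow> nat \<Rightarrow> nat" where
  "total_digit_sum c cs n = (\<Sum>a\<in>words c cs n. sum_list a)"

lemma num_words_Suc:
  "num_words c (q # qs) (Suc n) = q * num_words c c n + num_words c qs n"
  using sum_words_Suc[of "\<lambda>_. 1" c q qs n] by (simp add: num_words_def)

lemma total_digit_sum_Suc:
  "total_digit_sum c (q # qs) (Suc n) =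
    q * total_digit_sum c c n + (\<Sum>d<q. d) * num_words c c n + total_digit_sum c qs n + q * num_words c qs n"
  unfolding total_digit_sum_def sum_words_Suc
  by (simp add: sum.distrib num_words_def sum_distrib_left algebra_simps)

text \<open>
  A word is classified by the position \<open>i\<close> of its first restart; before that position it agrees with
  \<open>cs\<close>, and behind it stands an arbitrary admissible word. The additional \<open>1\<close> is the word that never restarts,
  which is the source of the \<open>+ 1\<close> in the initial values of a PLRS.
\<close>
lemma num_words_unfold:
  "num_words c cs n =
    (\<Sum>i<min n (length cs). cs ! i * num_words c c (n - 1 - i)) + (if n < length cs then 1 else 0)"
proof (induction cs arbitrary: n)
  case Nil
  then show ?case by (simp add: num_words_def words_Nil)
next
  case (Cons q qs)
  show ?case
  proof (cases n)
    case 0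
    then show ?thesis by (simp add: num_words_def words_0)
  next
    case (Suc m)
    show ?thesis unfolding Suc num_words_Suc Cons.IH[of m]
      by (simp add: sum.lessThan_Suc_shift del: sum.lessThan_Suc)
  qed
qed

text \<open>
  The sum of all digits in the blocks of length \<open>i + 1\<close> that end with a restart: such a
  block is \<open>take i cs @ [d]\<close> with \<open>d < cs ! i\<close>.
\<close>
definition block_weight :: "nat list \<Rightarrow> nat \<Rightarrow> nat" where
  "block_weight cs i = (\<Sum>d<cs ! i. sum_list (take i cs) + d)"

lemma total_digit_sum_unfold:
  assumes "length cs \<le> n"
  shows "total_digit_sum c cs n =
    (\<Sum>i<length cs. cs ! i * total_digit_sum c c (n - 1 - i) + block_weight cs i * num_words c c (n - 1 - i))"
  using assms
proof (induction cs arbitrary: n)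
  case Nil
  then show ?case by (simp add: total_digit_sum_def words_Nil)
next
  case (Cons q qs)
  then obtain m where n: "n = Suc m" and m: "length qs \<le> m" by (cases n) auto
  have w: "block_weight (q # qs) (Suc i) = block_weight qs i + q * qs ! i" for i
    by (simp add: block_weight_def sum.distrib algebra_simps)
  have N: "num_words c qs m = (\<Sum>i<length qs. qs ! i * num_words c c (m - 1 - i))"
    using num_words_unfold[of c qs m] m by (simp add: min_def)
  have "block_weight (q # qs) 0 = (\<Sum>d<q. d)" by (simp add: block_weight_def)
  then show ?case unfolding n total_digit_sum_Suc Cons.IH[OF m] N length_Cons
    by (simp add: sum.lessThan_Suc_shift w sum.distrib sum_distrib_left algebra_simps
        del: sum.lessThan_Suc)
qed

lemma num_words_pos:
  assumes "c \<noteq> []" "c ! 0 > 0"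
  shows "0 < num_words c c n"
proof -
  have "admissible c c []" using assms(1) by (cases c) auto
  then have "replicate n 0 \<in> words c c n"
    using admissible_zeros[OF assms, of n "[]"] by (simp add: words_def)
  then show ?thesis using finite_words by (auto simp: num_words_def card_gt_0_iff)
qed

lemma plrs_coeffs_sum_gt_1:
  assumes "plrs_coeffs c"
  shows "1 < (\<Sum>i<length c. c ! i)"
proof (cases "length c = 1")
  case True
  then show ?thesis using assms by (simp add: plrs_coeffs_def)
next
  case False
  have "(\<Sum>i\<in>{0, length c - 1}. c ! i) \<le> (\<Sum>i<length c. c ! i)"
    using assms by (intro sum_mono2) (auto simp: plrs_coeffs_def)
  moreover have "length c - 1 \<noteq> 0"
  proof -
    have "0 < length c" using assms by (simp add: plrs_coeffs_def)
    then show ?thesis using False by linarith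
  qed
  ultimately show ?thesis using assms by (simp add: plrs_coeffs_def)
qed

text \<open>
  This is what makes the slope of the mean positive. The largest digit \<open>d = c\<^sub>L - 1\<close> contributes
  \<open>c\<^sub>1 + \<dots> + c\<^sub>L - 1\<close>; the term \<open>c\<^sub>1\<close> makes it positive if \<open>L > 1\<close>, and the assumption \<open>c\<^sub>1 > 1\<close> if \<open>L = 1\<close>.
\<close>
lemma block_weight_pos:
  assumes "plrs_coeffs c"
  shows "0 < block_weight c (length c - 1)"
proof -
  let ?l = "length c - 1" let ?d = "c ! ?l - 1"
  have c: "c \<noteq> []" "0 < c ! 0" "0 < c ! ?l" using assms by (auto simp: plrs_coeffs_def)
  have "0 < sum_list (take ?l c) + ?d"
  proof (cases "length c = 1")
    case True
    then show ?thesis using assms by (simp add: plrs_coeffs_def)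
  next
    case False
    then have "1 < length c" using c by (cases c) auto
    then have "c ! 0 \<in> set (take ?l c)"
      by (auto simp: in_set_conv_nth intro!: exI[of _ 0])
    then show ?thesis using member_le_sum_list[of "c ! 0" "take ?l c"] c by linarith
  qed
  also have "\<dots> \<le> block_weight c ?l"
    unfolding block_weight_def using c by (intro member_le_sum) auto
  finally show ?thesis .
qed

section \<open>Legal decompositions as positional notation\<close>

text \<open>
  The defining recurrence of a PLRS is the recurrence \<open>num_words_unfold\<close> in the initial state, so
  the sequence is determined by its coefficients.
\<close>
lemma PLRS_num_words:
  assumes "PLRS c H"
  shows "H (n + 1) = num_words c c n"
proof (induction n rule: less_induct)
  case (less n)
  have ne: "c \<noteq> []" using assms by (auto simp: PLRS_def plrs_coeffs_def)
  have eq: "(\<Sum>i=1..k. c ! (i - 1) * H (n + 1 - i)) = (\<Sum>i<k. c ! i * num_words c c (n - 1 - i))"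
    if "k \<le> n" for k
  proof -
    have "(\<Sum>i=1..k. c ! (i - 1) * H (n + 1 - i)) = (\<Sum>i<k. c ! i * H (n - i))"
      by (rule sum.reindex_bij_witness[of _ Suc "\<lambda>i. i - 1"]) auto
    also have "\<dots> = (\<Sum>i<k. c ! i * num_words c c (n - 1 - i))"
    proof (rule sum.cong[OF refl])
      fix i assume "i \<in> {..<k}"
      then have "n - i = (n - 1 - i) + 1" "n - 1 - i < n" using that by auto
      then show "c ! i * H (n - i) = c ! i * num_words c c (n - 1 - i)" using less by metis
    qed
    finally show ?thesis .
  qed
  consider "n = 0" | "1 \<le> n" "n < length c" | "length c \<le> n" by linarith
  then show ?case
  proof cases
    case 1
    then show ?thesis using assms ne num_words_unfold[of c c 0] by (simp add: PLRS_def)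
  next
    case 2
    then show ?thesis
      using assms eq[of n] num_words_unfold[of c c n] by (simp add: PLRS_def min_def)
  next
    case 3
    then have "H (n + 1) = (\<Sum>i=1..length c. c ! (i - 1) * H (n + 1 - i))"
      using assms by (simp add: PLRS_def)
    then show ?thesis
      using 3 eq[of "length c"] num_words_unfold[of c c n] by (simp add: min_def)
  qed
qed

definition word_value :: "(nat \<Rightarrow> nat) \<Rightarrow> nat list \<Rightarrow> nat" where
  "word_value H a = (\<Sum>i=1..length a. a ! (i - 1) * H (length a + 1 - i))"

lemma word_value_Nil [simp]: "word_value H [] = 0"
  by (simp add: word_value_def)

lemma word_value_Cons [simp]: "word_value H (d # b) = d * H (length b + 1) + word_value H b"
proof -
  have "word_value H (d # b) = d * H (length b + 1)
      + (\<Sum>i=2..Suc (length b). (d # b) ! (i - 1) * H (length b + 2 - i))"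
    unfolding word_value_def
    by (subst sum.atLeast_Suc_atMost) (simp_all add: numeral_2_eq_2 del: sum.cl_ivl_Suc)
  also have "(\<Sum>i=2..Suc (length b). (d # b) ! (i - 1) * H (length b + 2 - i)) = word_value H b"
    unfolding word_value_def
    by (rule sum.reindex_bij_witness[of _ Suc "\<lambda>i. i - 1"]) (auto simp: nth_Cons' Suc_diff_le)
  finally show ?thesis .
qed

lemma word_value_zeros [simp]: "word_value H (replicate k 0 @ b) = word_value H b"
  by (induction k) auto

text \<open>
  The words that start with a given digit \<open>d\<close> have values that fill an interval starting at
  \<open>d * H (n + 1)\<close>, by induction. For \<open>d < q\<close> this interval has length \<open>H (n + 1)\<close>, and only for \<open>d = q\<close> may
  its length differ, so the intervals are adjacent and cover an initial segment of the naturals.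
\<close>
lemma bij_betw_word_value:
  assumes H: "\<And>n. H (n + 1) = num_words c c n"
  shows "bij_betw (word_value H) (words c cs n) {0..<num_words c cs n}"
proof (induction n arbitrary: cs)
  case 0
  show ?case
    by (cases cs) (auto simp: words_Nil words_0 num_words_def bij_betw_def)
next
  case (Suc n)
  show ?case
  proof (cases cs)
    case Nil
    then show ?thesis by (simp add: words_Nil num_words_def bij_betw_def)
  next
    case (Cons q qs)
    let ?h = "num_words c c n"
    have len: "length b = n" if "b \<in> words c es n" for b es using that by (simp add: words_def)
    have shift: "bij_betw (word_value H) ((#) d ` words c es n) {d * ?h..<d * ?h + num_words c es n}"
      for d es
    proof -
      have 1: "bij_betw ((+) (d * ?h) \<circ> word_value H) (words c es n) {d * ?h..<d * ?h + num_words c es n}"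
        by (rule bij_betw_trans[OF Suc]) (auto simp: bij_betw_def image_add_atLeastLessThan)
      have 2: "(word_value H \<circ> (#) d) b = ((+) (d * ?h) \<circ> word_value H) b" if "b \<in> words c es n" for b
        using len[OF that] H[of n] by simp
      have "bij_betw (word_value H \<circ> (#) d) (words c es n) {d * ?h..<d * ?h + num_words c es n}"
        using 1 bij_betw_cong[of "words c es n" "word_value H \<circ> (#) d"] 2 by blast
      then show ?thesis
        using bij_betw_comp_iff[of "(#) d" "words c es n" "(#) d ` words c es n" "word_value H"]
        by (simp add: bij_betw_def)
    qed
    have blocks: "bij_betw (word_value H) (\<Union>d<r. (#) d ` words c c n) {0..<r * ?h}" for r
    proof (induction r)
      case 0
      then show ?case by (simp add: bij_betw_def)
    next
      case (Suc r)
      have "bij_betw (word_value H) ((\<Union>d<r. (#) d ` words c c n) \<union> (#) r ` words c c n)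
          ({0..<r * ?h} \<union> {r * ?h..<r * ?h + ?h})"
        by (rule bij_betw_combine[OF Suc shift]) auto
      moreover have "{0..<r * ?h} \<union> {r * ?h..<r * ?h + ?h} = {0..<Suc r * ?h}"
        by auto
      ultimately show ?case by (simp add: lessThan_Suc Un_commute)
    qed
    have "bij_betw (word_value H) (words c cs (Suc n))
        ({0..<q * ?h} \<union> {q * ?h..<q * ?h + num_words c qs n})"
      unfolding Cons words_Suc by (rule bij_betw_combine[OF blocks shift]) auto
    moreover have "{0..<q * ?h} \<union> {q * ?h..<q * ?h + num_words c qs n} = {0..<num_words c cs (Suc n)}"
      unfolding Cons num_words_Suc by auto
    ultimately show ?thesis by simp
  qed
qed

text \<open>
  Two words of different lengths are compared after padding the shorter one with leading zeros.
\<close>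
lemma legal_word_value_inj:
  assumes H: "\<And>n. H (n + 1) = num_words c c n" and c: "c \<noteq> []" "c ! 0 > 0"
    and "admissible c c a" "a \<noteq> [] \<Longrightarrow> hd a > 0"
    and "admissible c c b" "b \<noteq> [] \<Longrightarrow> hd b > 0"
    and "word_value H a = word_value H b"
  shows "a = b"
proof -
  have *: "a = b" if ab: "length a \<le> length b" "admissible c c a" "admissible c c b"
    "b \<noteq> [] \<Longrightarrow> hd b > 0" "word_value H a = word_value H b" for a b
  proof -
    define k where "k = length b - length a"
    have "replicate k 0 @ a \<in> words c c (length b)" "b \<in> words c c (length b)"
      using ab by (auto simp: words_def k_def admissible_zeros[OF c])
    moreover have "word_value H (replicate k 0 @ a) = word_value H b" using ab by simp
    ultimately have eq: "replicate k 0 @ a = b"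
      using bij_betw_word_value[OF H, of c "length b"] unfolding bij_betw_def inj_on_def by blast
    then have "k = 0" using ab(4) by (cases k) auto
    then show ?thesis using eq by simp
  qed
  show ?thesis using *[of a b] *[of b a] assms by (metis nat_le_linear)
qed

text \<open>
  The integers below \<open>H (n + 2)\<close> are the values of the words of length \<open>n + 1\<close>, and those below
  \<open>H (n + 1)\<close> are the values of such words with first digit \<open>0\<close>. The difference consists
  of words with nonzero first digit, which are exactly the legal decompositions.
\<close>
lemma sum_num_summands:
  assumes P: "PLRS c H"
  shows "(\<Sum>N\<in>{H (n + 1)..<H (n + 2)}. num_summands c H N)
    = total_digit_sum c c (Suc n) - total_digit_sum c c n"
    and "total_digit_sum c c n \<le> total_digit_sum c c (Suc n)"
proof -
  have H: "H (n + 1) = num_words c c n" for n using PLRS_num_words[OF P] .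
  have c: "c \<noteq> []" "c ! 0 > 0" using P by (auto simp: PLRS_def plrs_coeffs_def)
  let ?Z = "(#) 0 ` words c c n"
  let ?S = "words c c (Suc n) - ?Z"
  have sub: "?Z \<subseteq> words c c (Suc n)"
    using admissible_zeros[OF c, of 1] by (auto simp: words_def)
  have all: "bij_betw (word_value H) (words c c (Suc n)) {0..<H (n + 2)}"
    using bij_betw_word_value[OF H, of c "Suc n"] H[of "Suc n"] by simp
  have "bij_betw (word_value H) (words c c n) {0..<H (n + 1)}"
    using bij_betw_word_value[OF H, of c n] H by simp
  then have img: "word_value H ` ?Z = {0..<H (n + 1)}"
    by (simp add: image_image bij_betw_def)
  have "word_value H ` ?Z \<subseteq> word_value H ` words c c (Suc n)" using sub by blast
  then have mono: "H (n + 1) \<le> H (n + 2)"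
    using all P unfolding img by (auto simp: bij_betw_def PLRS_def)
  have "word_value H ` ?S = {0..<H (n + 2)} - {0..<H (n + 1)}"
    using all img sub inj_on_image_set_diff[of "word_value H" "words c c (Suc n)" "words c c (Suc n)" ?Z]
    by (simp add: bij_betw_def)
  also have "\<dots> = {H (n + 1)..<H (n + 2)}" by auto
  finally have bij: "bij_betw (word_value H) ?S {H (n + 1)..<H (n + 2)}"
    using all by (auto simp: bij_betw_def intro: inj_on_diff)
  have ns: "num_summands c H (word_value H a) = sum_list a" if "a \<in> ?S" for a
  proof -
    have adm: "admissible c c a" and len: "length a = Suc n" using that by (auto simp: words_def)
    have hd: "hd a > 0"
    proof (rule ccontr)
      assume "\<not> hd a > 0"
      then obtain b where "a = 0 # b" using len by (cases a) auto
      then have "a \<in> ?Z" using adm len admissible_zeros[OF c, of 1 b] by (auto simp: words_def)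
      then show False using that by blast
    qed
    have "(THE a'. legal_decomposition c H (word_value H a) a') = a"
    proof (rule the_equality)
      show "legal_decomposition c H (word_value H a) a"
        using admissible_imp_legal[OF c adm] hd
        by (simp add: legal_decomposition_def word_value_def)
      fix b assume "legal_decomposition c H (word_value H a) b"
      then have b: "legal c b" "word_value H a = word_value H b"
        by (auto simp: legal_decomposition_def word_value_def)
      have "b \<noteq> [] \<Longrightarrow> hd b > 0" using b(1) by cases (auto simp: hd_conv_nth)
      then show "b = a"
        using legal_word_value_inj[OF H c legal_imp_admissible[OF c b(1)] _ adm] hd b(2) by simp
    qed
    then show ?thesis by (simp add: num_summands_def)
  qed
  have "total_digit_sum c c (Suc n) = (\<Sum>a\<in>?S. sum_list a) + (\<Sum>a\<in>?Z. sum_list a)"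
    unfolding total_digit_sum_def using sum.subset_diff[OF sub finite_words] .
  also have "(\<Sum>a\<in>?Z. sum_list a) = total_digit_sum c c n"
    by (simp add: sum.reindex total_digit_sum_def)
  also have "(\<Sum>a\<in>?S. sum_list a) = (\<Sum>N\<in>{H (n + 1)..<H (n + 2)}. num_summands c H N)"
    using sum.reindex_bij_betw[OF bij, of "num_summands c H"] ns by simp
  finally show "(\<Sum>N\<in>{H (n + 1)..<H (n + 2)}. num_summands c H N)
    = total_digit_sum c c (Suc n) - total_digit_sum c c n"
    and "total_digit_sum c c n \<le> total_digit_sum c c (Suc n)" by simp_all
qed

lemma mean_summands_eq:
  assumes P: "PLRS c H" and lt: "num_words c c n < num_words c c (Suc n)"
  shows "mean_summands c H (Suc n) =
    (real (total_digit_sum c c (Suc n)) - real (total_digit_sum c c n)) /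
    (real (num_words c c (Suc n)) - real (num_words c c n))"
proof -
  have H: "H (Suc n) = num_words c c n" "H (Suc (Suc n)) = num_words c c (Suc n)"
    using PLRS_num_words[OF P, of n] PLRS_num_words[OF P, of "Suc n"] by simp_all
  have "mean_summands c H (Suc n) =
      (\<Sum>N\<in>{H (Suc n)..<H (Suc (Suc n))}. real (num_summands c H N)) / card {H (Suc n)..<H (Suc (Suc n))}"
    unfolding mean_summands_def Suc_eq_plus1[symmetric] using lt H
    by (subst integral_pmf_of_set) auto
  also have "(\<Sum>N\<in>{H (Suc n)..<H (Suc (Suc n))}. real (num_summands c H N))
      = real (total_digit_sum c c (Suc n)) - real (total_digit_sum c c n)"
    using sum_num_summands[OF P, of n] by (simp add: of_nat_sum[symmetric] of_nat_diff del: of_nat_sum)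
  also have "real (card {H (Suc n)..<H (Suc (Suc n))}) = real (num_words c c (Suc n)) - real (num_words c c n)"
    using lt by (simp add: H of_nat_diff)
  finally show ?thesis .
qed

section \<open>Geometrically small sequences\<close>

text \<open>
  The rate is quantified inside the definition, so that the notion is closed under sums and under
  multiplication by the index, which enlarge the rate.
\<close>
definition geometrically_small :: "(nat \<Rightarrow> real) \<Rightarrow> bool" where
  "geometrically_small r \<longleftrightarrow> (\<exists>\<rho>. 0 < \<rho> \<and> \<rho> < 1 \<and> r \<in> O(\<lambda>n. \<rho> ^ n))"

lemma geometrically_smallI:
  assumes "0 < \<rho>" "\<rho> < 1" "\<And>n. n0 \<le> n \<Longrightarrow> \<bar>r n\<bar> \<le> B * \<rho> ^ n"
  shows "geometrically_small r"
  unfolding geometrically_small_def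
proof (intro exI conjI)
  show "r \<in> O(\<lambda>n. \<rho> ^ n)"
    using assms by (intro bigoI[of _ B] eventually_sequentiallyI[of n0]) auto
qed (use assms in auto)

text \<open>
  The bound holds for every index and not only eventually: finitely many values are absorbed by
  the constant.
\<close>
lemma geometrically_smallE:
  assumes "geometrically_small r"
  obtains B \<rho> where "0 < \<rho>" "\<rho> < 1" "0 < B" "\<And>n. \<bar>r n\<bar> \<le> B * \<rho> ^ n"
proof -
  obtain \<rho> where \<rho>: "0 < \<rho>" "\<rho> < 1" "r \<in> O(\<lambda>n. \<rho> ^ n)"
    using assms by (auto simp: geometrically_small_def)
  from \<rho>(3) obtain D where "D > 0" "eventually (\<lambda>n. norm (r n) \<le> D * norm (\<rho> ^ n)) sequentially"
    by (rule landau_o.bigE)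
  then obtain N where N: "\<And>n. n \<ge> N \<Longrightarrow> \<bar>r n\<bar> \<le> D * \<rho> ^ n"
    using \<rho> by (auto simp: eventually_sequentially)
  define S where "S = (\<Sum>k<N. \<bar>r k\<bar> / \<rho> ^ k)"
  have "S \<ge> 0" unfolding S_def using \<rho> by (intro sum_nonneg) auto
  have "\<bar>r n\<bar> \<le> (D + S) * \<rho> ^ n" for n
  proof (cases "n < N")
    case True
    then have "\<bar>r n\<bar> / \<rho> ^ n \<le> S"
      unfolding S_def using \<rho> by (intro member_le_sum) auto
    also have "\<dots> \<le> D + S" using \<open>D > 0\<close> by simp
    finally show ?thesis using \<rho> by (simp add: field_simps)
  next
    case False
    then have "\<bar>r n\<bar> \<le> D * \<rho> ^ n" using N by simp
    also have "\<dots> \<le> (D + S) * \<rho> ^ n" using \<rho> \<open>S \<ge> 0\<close> by (intro mult_right_mono) auto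
    finally show ?thesis .
  qed
  then show thesis using that[of \<rho> "D + S"] \<rho> \<open>D > 0\<close> \<open>S \<ge> 0\<close> by simp
qed

lemma geometrically_small_cong:
  assumes "\<And>n. n0 \<le> n \<Longrightarrow> r n = s n" "geometrically_small s"
  shows "geometrically_small r"
proof -
  obtain B \<rho> where s: "0 < \<rho>" "\<rho> < 1" "0 < B" "\<And>n. \<bar>s n\<bar> \<le> B * \<rho> ^ n"
    using geometrically_smallE[OF assms(2)] by metis
  show ?thesis by (rule geometrically_smallI[of \<rho> n0 _ B]) (use s assms(1) in auto)
qed

lemma geometrically_small_Suc:
  assumes "geometrically_small r"
  shows "geometrically_small (\<lambda>n. r (Suc n))"
proof -
  obtain B \<rho> where r: "0 < \<rho>" "\<rho> < 1" "0 < B" "\<And>n. \<bar>r n\<bar> \<le> B * \<rho> ^ n"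
    using geometrically_smallE[OF assms] by metis
  show ?thesis
    by (rule geometrically_smallI[of \<rho> 0 _ "B * \<rho>"]) (use r(1,2) r(4)[of "Suc _"] in \<open>auto simp: mult.assoc\<close>)
qed

lemma geometrically_small_add:
  assumes "geometrically_small r" "geometrically_small s"
  shows "geometrically_small (\<lambda>n. r n + s n)"
proof -
  obtain B \<rho> where r: "0 < \<rho>" "\<rho> < 1" "0 < B" "\<And>n. \<bar>r n\<bar> \<le> B * \<rho> ^ n"
    using geometrically_smallE[OF assms(1)] by metis
  obtain D \<sigma> where s: "0 < \<sigma>" "\<sigma> < 1" "0 < D" "\<And>n. \<bar>s n\<bar> \<le> D * \<sigma> ^ n"
    using geometrically_smallE[OF assms(2)] by metis
  define \<tau> where "\<tau> = max \<rho> \<sigma>"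
  show ?thesis
  proof (rule geometrically_smallI[of \<tau> 0 _ "B + D"])
    fix n
    have "\<rho> ^ n \<le> \<tau> ^ n" "\<sigma> ^ n \<le> \<tau> ^ n"
      using r s by (auto simp: \<tau>_def intro!: power_mono)
    then have "B * \<rho> ^ n + D * \<sigma> ^ n \<le> (B + D) * \<tau> ^ n"
      using r(3) s(3) by (simp add: algebra_simps add_mono)
    then show "\<bar>r n + s n\<bar> \<le> (B + D) * \<tau> ^ n" using r(4)[of n] s(4)[of n] by linarith
  qed (use r s in \<open>auto simp: \<tau>_def\<close>)
qed

lemma geometrically_small_bigo_mult:
  assumes "f \<in> O(\<lambda>_. 1)" "geometrically_small r"
  shows "geometrically_small (\<lambda>n. f n * r n)"
proof -
  obtain \<rho> where \<rho>: "0 < \<rho>" "\<rho> < 1" "r \<in> O(\<lambda>n. \<rho> ^ n)"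
    using assms(2) by (auto simp: geometrically_small_def)
  then show ?thesis
    using landau_o.big.mult[OF assms(1) \<rho>(3)] by (auto simp: geometrically_small_def)
qed

lemma geometrically_small_cmult:
  "geometrically_small r \<Longrightarrow> geometrically_small (\<lambda>n. a * r n)"
  by (rule geometrically_small_bigo_mult) auto

lemma geometrically_small_diff:
  "geometrically_small r \<Longrightarrow> geometrically_small s \<Longrightarrow> geometrically_small (\<lambda>n. r n - s n)"
  using geometrically_small_add[of r "\<lambda>n. (-1) * s n"] geometrically_small_cmult[of s "-1"] by simp

lemma geometrically_small_0: "geometrically_small (\<lambda>n. 0)"
  by (rule geometrically_smallI[of "1/2" 0 _ 0]) auto

lemma geometrically_small_sum:
  "(\<And>i. i \<in> I \<Longrightarrow> geometrically_small (r i)) \<Longrightarrow> geometrically_small (\<lambda>n. \<Sum>i\<in>I. r i n)"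
  by (induction I rule: infinite_finite_induct)
    (auto intro: geometrically_small_add geometrically_small_0)

lemma geometrically_small_delay:
  assumes "geometrically_small r"
  shows "geometrically_small (\<lambda>n. r (n - k))"
proof -
  obtain B \<rho> where r: "0 < \<rho>" "\<rho> < 1" "0 < B" "\<And>n. \<bar>r n\<bar> \<le> B * \<rho> ^ n"
    using geometrically_smallE[OF assms] by metis
  show ?thesis
  proof (rule geometrically_smallI[of \<rho> k _ "B / \<rho> ^ k"])
    fix n assume "k \<le> n"
    then have "B * \<rho> ^ (n - k) = B / \<rho> ^ k * \<rho> ^ n" using r by (simp add: power_diff)
    then show "\<bar>r (n - k)\<bar> \<le> B / \<rho> ^ k * \<rho> ^ n" using r(4)[of "n - k"] by simp
  qed (use r in auto)
qed

lemma geometrically_small_linear_mult: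
  assumes "geometrically_small r"
  shows "geometrically_small (\<lambda>n. real n * r n)"
proof -
  obtain B \<rho> where r: "0 < \<rho>" "\<rho> < 1" "0 < B" "\<And>n. \<bar>r n\<bar> \<le> B * \<rho> ^ n"
    using geometrically_smallE[OF assms] by metis
  \<comment> \<open>One factor \<open>\<tau> ^ n\<close> of \<open>\<rho> ^ n = \<tau> ^ n * \<tau> ^ n\<close> absorbs the linear growth.\<close>
  define \<tau> where "\<tau> = sqrt \<rho>"
  have \<tau>: "0 < \<tau>" "\<tau> < 1" "\<tau> * \<tau> = \<rho>" using r by (auto simp: \<tau>_def)
  have "(\<lambda>n. real n * \<tau> ^ n) \<longlonglongrightarrow> 0" using powser_times_n_limit_0[of \<tau>] \<tau> by simp
  then have "Bseq (\<lambda>n. real n * \<tau> ^ n)" using convergent_imp_Bseq convergentI by blast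
  then obtain K where K: "\<And>n. norm (real n * \<tau> ^ n) \<le> K" by (auto simp: Bseq_def)
  show ?thesis
  proof (rule geometrically_smallI[of \<tau> 0 _ "K * B"])
    fix n
    have "\<bar>real n * r n\<bar> \<le> real n * (B * \<rho> ^ n)" using r(4)[of n] by (simp add: abs_mult mult_left_mono)
    also have "\<dots> = (real n * \<tau> ^ n) * (B * \<tau> ^ n)"
      by (simp add: \<tau>(3)[symmetric] power_mult_distrib)
    also have "\<dots> \<le> K * (B * \<tau> ^ n)"
      using K[of n] \<tau> r by (intro mult_right_mono) auto
    finally show "\<bar>real n * r n\<bar> \<le> K * B * \<tau> ^ n" by simp
  qed (use \<tau> in auto)
qed

lemma geometrically_small_tendsto:
  assumes "geometrically_small r"
  shows "r \<longlonglongrightarrow> 0"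
proof -
  obtain B \<rho> where r: "0 < \<rho>" "\<rho> < 1" "0 < B" "\<And>n. \<bar>r n\<bar> \<le> B * \<rho> ^ n"
    using geometrically_smallE[OF assms] by metis
  have "(\<lambda>n. B * \<rho> ^ n) \<longlonglongrightarrow> B * 0"
    using r by (intro tendsto_intros LIMSEQ_realpow_zero) auto
  then show ?thesis
    by (intro Lim_null_comparison[of r "\<lambda>n. B * \<rho> ^ n"]) (use r in auto)
qed

lemma geometrically_small_smallo:
  assumes "geometrically_small r"
  obtains \<gamma> where "0 < \<gamma>" "\<gamma> < 1" "r \<in> o(\<lambda>n. \<gamma> ^ n)"
proof -
  obtain \<rho> where \<rho>: "0 < \<rho>" "\<rho> < 1" "r \<in> O(\<lambda>n. \<rho> ^ n)"
    using assms by (auto simp: geometrically_small_def)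
  define \<gamma> where "\<gamma> = (1 + \<rho>) / 2"
  have \<gamma>: "\<rho> < \<gamma>" "0 < \<gamma>" "\<gamma> < 1" using \<rho> by (auto simp: \<gamma>_def)
  have "(\<lambda>n. (\<rho> / \<gamma>) ^ n) \<longlonglongrightarrow> 0" using \<rho> \<gamma> by (intro LIMSEQ_realpow_zero) auto
  then have "(\<lambda>n. \<rho> ^ n) \<in> o(\<lambda>n. \<gamma> ^ n)"
    using \<gamma> by (intro smalloI_tendsto) (auto simp: power_divide)
  then show thesis using that[of \<gamma>] \<gamma> landau_o.big_small_trans[OF \<rho>(3)] by blast
qed

lemma geometrically_small_increments_converge:
  assumes "geometrically_small (\<lambda>n. u (Suc n) - u n)"
  obtains l where "geometrically_small (\<lambda>n. u n - l)"
proof -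
  obtain B \<rho> where d: "0 < \<rho>" "\<rho> < 1" "0 < B" "\<And>n. \<bar>u (Suc n) - u n\<bar> \<le> B * \<rho> ^ n"
    using geometrically_smallE[OF assms] by metis
  define l where "l = u 0 + (\<Sum>n. u (Suc n) - u n)"
  have sg: "summable (\<lambda>k. B * \<rho> ^ k)" using d by (intro summable_mult) auto
  have sd: "summable (\<lambda>n. norm (u (Suc n) - u n))"
    by (rule summable_comparison_test[OF _ sg]) (use d in auto)
  show thesis
  proof (rule that[of l], rule geometrically_smallI[of \<rho> 0 _ "B / (1 - \<rho>)"])
    fix n
    have shift: "summable (\<lambda>k. norm (u (Suc (k + n)) - u (k + n)))"
      using summable_ignore_initial_segment[OF sd, of n] by simp
    have "(\<Sum>k<n. u (Suc k) - u k) = u n - u 0" by (rule sum_lessThan_telescope)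
    then have "l - u n = (\<Sum>k. u (Suc (k + n)) - u (k + n))"
      using suminf_split_initial_segment[OF summable_norm_cancel[OF sd], of n] by (simp add: l_def)
    then have "\<bar>u n - l\<bar> \<le> (\<Sum>k. norm (u (Suc (k + n)) - u (k + n)))"
      using summable_norm[OF shift] by (simp add: abs_minus_commute)
    also have "\<dots> \<le> (\<Sum>k. B * \<rho> ^ n * \<rho> ^ k)"
    proof (rule suminf_le[OF _ shift])
      show "summable (\<lambda>k. B * \<rho> ^ n * \<rho> ^ k)" using d by (intro summable_mult) auto
      show "norm (u (Suc (k + n)) - u (k + n)) \<le> B * \<rho> ^ n * \<rho> ^ k" for k
        using d(4)[of "k + n"] by (simp add: power_add mult_ac)
    qed
    also have "\<dots> = B / (1 - \<rho>) * \<rho> ^ n"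
      using d by (simp add: suminf_mult suminf_geometric)
    finally show "\<bar>u n - l\<bar> \<le> B / (1 - \<rho>) * \<rho> ^ n" .
  qed (use d in auto)
qed

section \<open>Recurrences that average over a window\<close>

lemma averaging_upper_bound:
  fixes p u :: "nat \<Rightarrow> real"
  assumes p: "\<And>i. i < L \<Longrightarrow> 0 \<le> p i" "(\<Sum>i<L. p i) = 1" and R: "0 \<le> R"
    and rec: "\<And>t. n + L \<le> t \<Longrightarrow> u t \<le> (\<Sum>i<L. p i * u (t - 1 - i)) + R"
    and window: "\<And>t. n \<le> t \<Longrightarrow> t < n + L \<Longrightarrow> u t \<le> M"
  shows "u (n + k) \<le> M + real k * R"
proof (induction k rule: less_induct)
  case (less k)
  show ?case
  proof (cases "k < L")
    case True
    then show ?thesis using window[of "n + k"] R by (simp add: add_increasing2)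
  next
    case False
    have "0 < L" using p(2) by (cases L) auto
    have "(\<Sum>i<L. p i * u (n + k - 1 - i)) \<le> (\<Sum>i<L. p i * (M + real (k - 1) * R))"
    proof (intro sum_mono mult_left_mono)
      fix i assume i: "i \<in> {..<L}"
      then have "n + k - 1 - i = n + (k - 1 - i)" "k - 1 - i < k" using False by auto
      then have "u (n + k - 1 - i) \<le> M + real (k - 1 - i) * R" using less by metis
      also have "\<dots> \<le> M + real (k - 1) * R" using R by (intro add_left_mono mult_right_mono) auto
      finally show "u (n + k - 1 - i) \<le> M + real (k - 1) * R" .
      show "0 \<le> p i" using p i by simp
    qed
    also have "\<dots> = M + real (k - 1) * R" by (simp add: sum_distrib_right[symmetric] p)
    finally have "u (n + k) \<le> M + real (k - 1) * R + R" using rec[of "n + k"] False by simp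
    also have "\<dots> = M + real k * R" using False \<open>0 < L\<close> by (simp add: of_nat_diff algebra_simps)
    finally show ?thesis .
  qed
qed

text \<open>
  Let \<open>j\<close> be the place of the minimum in the window. The last weight transports this low value to
  index \<open>j + L\<close>, which lies beyond the window, and the first weight transports it from there to
  all later indices, losing a factor \<open>p 0\<close> per step. After \<open>2 * L\<close> steps every entry of the window
  is therefore below the old maximum by the fraction \<open>p (L - 1) * p 0 ^ (2 * L)\<close> of the old
  oscillation. Each step adds an error of at most \<open>R\<close>, and the indices involved range over \<open>3 * L\<close>
  steps, which accounts for the error term.
\<close>
lemma averaging_window_contraction:
  fixes p u :: "nat \<Rightarrow> real"
  assumes p: "\<And>i. i < L \<Longrightarrow> 0 \<le> p i" "(\<Sum>i<L. p i) = 1"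
    and rec: "\<And>t. n + L \<le> t \<Longrightarrow> \<bar>u t - (\<Sum>i<L. p i * u (t - 1 - i))\<bar> \<le> R"
    and window: "\<And>s t. s \<in> {n..<n + L} \<Longrightarrow> t \<in> {n..<n + L} \<Longrightarrow> \<bar>u s - u t\<bar> \<le> W"
    and st: "s \<in> {n + 2 * L..<n + 3 * L}" "t \<in> {n + 2 * L..<n + 3 * L}"
  shows "\<bar>u s - u t\<bar> \<le> (1 - p (L - 1) * p 0 ^ (2 * L)) * W + 9 * real L * R"
proof -
  have L: "0 < L" using p(2) by (cases L) auto
  have R: "0 \<le> R" using rec[of "n + L"] by linarith
  have p_le: "p i \<le> 1" if "i < L" for i
    using member_le_sum[of i "{..<L}" p] p that by simp
  have p0: "0 \<le> p 0" "p 0 \<le> 1" and pl: "0 \<le> p (L - 1)" "p (L - 1) \<le> 1" using p p_le L by auto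
  define \<epsilon> where "\<epsilon> = p (L - 1) * p 0 ^ (2 * L)"
  define E where "E = 3 * real L * R"
  have fin: "finite (u ` {n..<n + L})" and ne: "u ` {n..<n + L} \<noteq> {}" using L by auto
  obtain j where j: "j \<in> {n..<n + L}" "u j = Min (u ` {n..<n + L})"
    using Min_in[OF fin ne] by force
  obtain J where J: "J \<in> {n..<n + L}" "u J = Max (u ` {n..<n + L})"
    using Max_in[OF fin ne] by force
  have "0 \<le> E" using R by (simp add: E_def)
  have kE: "real k * R \<le> E" if "k \<le> 3 * L" for k
  proof -
    have "real k \<le> 3 * real L" using that by linarith
    then show ?thesis unfolding E_def by (intro mult_right_mono R) auto
  qed
  have upper: "u t \<le> u J + E" if "n \<le> t" "t < n + 3 * L" for t
  proof -
    have "u (n + (t - n)) \<le> u J + real (t - n) * R"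
      by (rule averaging_upper_bound[OF p R]) (use rec J in \<open>fastforce simp: abs_le_iff\<close>)+
    moreover have "real (t - n) * R \<le> E" by (rule kE) (use that in linarith)
    ultimately show ?thesis using that by simp
  qed
  have lower: "u j - E \<le> u t" if "n \<le> t" "t < n + 3 * L" for t
  proof -
    have "- u (n + (t - n)) \<le> - u j + real (t - n) * R"
    proof (rule averaging_upper_bound[where u = "\<lambda>t. - u t", OF p R])
      fix t assume "n + L \<le> t"
      then show "- u t \<le> (\<Sum>i<L. p i * - u (t - 1 - i)) + R"
        using rec[of t] by (simp add: sum_negf abs_le_iff)
    qed (use j in auto)
    moreover have "real (t - n) * R \<le> E" by (rule kE) (use that in linarith)
    ultimately show ?thesis using that by simp
  qed
  define V where "V = u J + E"
  have Vj: "0 \<le> V - u j" using upper[of j] j by (auto simp: V_def)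
  have step: "p i * (V - u (t - 1 - i)) - R \<le> V - u t"
    if "n + L \<le> t" "t < n + 3 * L" "i < L" for t i
  proof -
    have "p i * (V - u (t - 1 - i)) \<le> (\<Sum>i<L. p i * (V - u (t - 1 - i)))"
    proof (rule member_le_sum)
      fix k assume k: "k \<in> {..<L} - {i}"
      then have "u (t - 1 - k) \<le> V" unfolding V_def by (intro upper) (use that in auto)
      then show "0 \<le> p k * (V - u (t - 1 - k))" using p k by simp
    qed (use that in auto)
    also have "\<dots> = V - (\<Sum>i<L. p i * u (t - 1 - i))"
      by (simp add: right_diff_distrib sum_subtractf sum_distrib_right[symmetric] p)
    also have "\<dots> \<le> V - u t + R" using rec[OF that(1)] by linarith
    finally show ?thesis by simp
  qed
  \<comment> \<open>The low value at \<open>j\<close> reaches \<open>j + L\<close> with the last weight, then moves on with the first.\<close>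
  have chain: "p (L - 1) * p 0 ^ k * (V - u j) - real (Suc k) * R \<le> V - u (j + L + k)"
    if "j + L + k < n + 3 * L" for k
    using that
  proof (induction k)
    case 0
    then show ?case using step[of "j + L" "L - 1"] j L by simp
  next
    case (Suc k)
    have "p (L - 1) * p 0 ^ Suc k * (V - u j) - real (Suc (Suc k)) * R
        = p 0 * (p (L - 1) * p 0 ^ k * (V - u j)) - real (Suc k) * R - R"
      by (simp add: algebra_simps)
    also have "\<dots> \<le> p 0 * (p (L - 1) * p 0 ^ k * (V - u j)) - p 0 * (real (Suc k) * R) - R"
      using p0 R by (intro diff_right_mono diff_left_mono mult_left_le_one_le) auto
    also have "\<dots> = p 0 * (p (L - 1) * p 0 ^ k * (V - u j) - real (Suc k) * R) - R"
      by (simp add: algebra_simps)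
    also have "\<dots> \<le> p 0 * (V - u (j + L + k)) - R"
      using Suc p0 by (intro diff_right_mono mult_left_mono) auto
    also have "\<dots> \<le> V - u (j + L + Suc k)"
      using step[of "j + L + Suc k" 0] Suc j L by simp
    finally show ?case .
  qed
  have improved: "u t \<le> V - \<epsilon> * (V - u j) + E" if "t \<in> {n + 2 * L..<n + 3 * L}" for t
  proof -
    define k where "k = t - (j + L)"
    have k: "t = j + L + k" "Suc k \<le> 2 * L" using that j by (auto simp: k_def)
    have "\<epsilon> \<le> p (L - 1) * p 0 ^ k"
      unfolding \<epsilon>_def using p0 pl k by (intro mult_left_mono power_decreasing) auto
    then have "\<epsilon> * (V - u j) \<le> p (L - 1) * p 0 ^ k * (V - u j)"
      using Vj by (rule mult_right_mono)
    also have "\<dots> \<le> V - u t + real (Suc k) * R" using chain[of k] that k by simp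
    also have "\<dots> \<le> V - u t + E" using kE[of "Suc k"] k by simp
    finally show ?thesis by simp
  qed
  have \<epsilon>: "0 \<le> \<epsilon>" "\<epsilon> \<le> 1" using p0 pl by (auto simp: \<epsilon>_def intro!: mult_le_one power_le_one)
  have "u s - u t \<le> (1 - \<epsilon>) * W + 9 * real L * R" 
    if "s \<in> {n + 2 * L..<n + 3 * L}" "t \<in> {n + 2 * L..<n + 3 * L}" for s t
  proof -
    have "u s - u t \<le> V - \<epsilon> * (V - u j) + E - (u j - E)"
      using improved[OF that(1)] lower[of t] that by simp
    also have "\<dots> = (1 - \<epsilon>) * (u J - u j) + ((1 - \<epsilon>) * E + 2 * E)" by (simp add: V_def algebra_simps)
    also have "\<dots> \<le> (1 - \<epsilon>) * W + (1 * E + 2 * E)"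
      using \<epsilon> window[OF J(1) j(1)] \<open>0 \<le> E\<close>
      by (intro add_mono mult_left_mono mult_right_mono) auto
    finally show ?thesis by (simp add: E_def mult_ac)
  qed
  from this[OF st] this[OF st(2,1)] show ?thesis by (simp add: \<epsilon>_def abs_le_iff)
qed

text \<open>
  By \<open>averaging_window_contraction\<close> the oscillation over a window decays geometrically, with any
  rate close enough to one to dominate both the contraction and the error. Since the
  next term is an average over the window up to the error, the increments decay at the same rate,
  and the sequence converges.
\<close>
lemma averaging_recurrence_converges:
  fixes p u :: "nat \<Rightarrow> real"
  assumes p: "\<And>i. i < L \<Longrightarrow> 0 \<le> p i" "(\<Sum>i<L. p i) = 1" "0 < p 0" "0 < p (L - 1)"
    and small: "geometrically_small (\<lambda>n. u n - (\<Sum>i<L. p i * u (n - 1 - i)))"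
  obtains l where "geometrically_small (\<lambda>n. u n - l)"
proof -
  have L: "0 < L" using p(2) by (cases L) auto
  obtain K \<rho> where r: "0 < \<rho>" "\<rho> < 1" "0 < K"
    "\<And>n. \<bar>u n - (\<Sum>i<L. p i * u (n - 1 - i))\<bar> \<le> K * \<rho> ^ n"
    using geometrically_smallE[OF small] by metis
  have p_le: "p i \<le> 1" if "i < L" for i
    using member_le_sum[of i "{..<L}" p] p that by simp
  define \<epsilon> where "\<epsilon> = p (L - 1) * p 0 ^ (2 * L)"
  have \<epsilon>: "0 < \<epsilon>" "\<epsilon> \<le> 1"
    using p p_le L by (auto simp: \<epsilon>_def intro!: mult_le_one power_le_one)
  \<comment> \<open>The rate satisfies \<open>\<sigma> ^ (2 * L) \<ge> 1 - \<epsilon> / 2\<close> by Bernoulli. Half of the gain \<open>\<epsilon>\<close> of a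
    contraction pays for this loss, and the other half for the error term.\<close>
  define \<sigma> where "\<sigma> = max \<rho> (1 - \<epsilon> / (4 * real L))"
  have "0 < \<epsilon> / (4 * real L)" "\<epsilon> / (4 * real L) < 1" using \<epsilon> L by (auto simp: field_simps)
  then have \<sigma>: "0 < \<sigma>" "\<sigma> < 1" "\<rho> \<le> \<sigma>" using r by (auto simp: \<sigma>_def)
  have "1 - \<epsilon> / 2 = 1 + real (2 * L) * (- (\<epsilon> / (4 * real L)))" using L by (simp add: field_simps)
  also have "\<dots> \<le> (1 + (- (\<epsilon> / (4 * real L)))) ^ (2 * L)"
    using \<open>\<epsilon> / (4 * real L) < 1\<close> by (intro Bernoulli_inequality) auto
  also have "\<dots> \<le> \<sigma> ^ (2 * L)"
    using \<open>\<epsilon> / (4 * real L) < 1\<close> by (intro power_mono) (auto simp: \<sigma>_def)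
  finally have \<sigma>pow: "1 - \<epsilon> / 2 \<le> \<sigma> ^ (2 * L)" .
  have err: "\<bar>u t - (\<Sum>i<L. p i * u (t - 1 - i))\<bar> \<le> K * \<sigma> ^ n" if "n \<le> t" for n t
  proof -
    have "\<rho> ^ t \<le> \<sigma> ^ t" using r \<sigma> by (intro power_mono) auto
    also have "\<dots> \<le> \<sigma> ^ n" using \<sigma> that by (intro power_decreasing) auto
    finally have "K * \<rho> ^ t \<le> K * \<sigma> ^ n" using r by simp
    then show ?thesis using r(4)[of t] by linarith
  qed
  define D where "D = Max ((\<lambda>(s, t). \<bar>u s - u t\<bar>) ` ({..<3 * L} \<times> {..<3 * L}))"
  have D: "\<bar>u s - u t\<bar> \<le> D" if "s < 3 * L" "t < 3 * L" for s t
    unfolding D_def using that by (intro Max_ge) (auto intro!: image_eqI[of _ _ "(s, t)"])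
  \<comment> \<open>The first argument serves the windows that start below \<open>2 * L\<close>, the second the induction step.\<close>
  define B where "B = max (D / \<sigma> ^ (2 * L)) (18 * real L * K / \<epsilon>)"
  have B: "D \<le> B * \<sigma> ^ (2 * L)" "9 * real L * K \<le> B * (\<epsilon> / 2)"
    using \<sigma> \<epsilon> by (auto simp: B_def max_def field_simps)
  have "0 \<le> B" using r \<epsilon> by (auto simp: B_def le_max_iff_disj)
  have osc: "\<bar>u s - u t\<bar> \<le> B * \<sigma> ^ n" if "s \<in> {n..<n + L}" "t \<in> {n..<n + L}" for n s t
    using that
  proof (induction n arbitrary: s t rule: less_induct)
    case (less n)
    show ?case
    proof (cases "n < 2 * L")
      case True
      then have "\<bar>u s - u t\<bar> \<le> D" using less.prems by (intro D) auto
      also have "\<dots> \<le> B * \<sigma> ^ (2 * L)" by (rule B)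
      also have "\<dots> \<le> B * \<sigma> ^ n" using True \<sigma> \<open>0 \<le> B\<close> by (intro mult_left_mono power_decreasing) auto
      finally show ?thesis .
    next
      case False
      then obtain m where m: "n = m + 2 * L" by (metis add.commute le_add_diff_inverse not_less)
      have "\<bar>u s - u t\<bar> \<le> (1 - \<epsilon>) * (B * \<sigma> ^ m) + 9 * real L * (K * \<sigma> ^ m)"
        unfolding \<epsilon>_def
      proof (rule averaging_window_contraction[OF p(1,2)])
        show "\<bar>u s - u t\<bar> \<le> B * \<sigma> ^ m" if "s \<in> {m..<m + L}" "t \<in> {m..<m + L}" for s t
          using less.IH[OF _ that] m L by simp
        show "\<bar>u t - (\<Sum>i<L. p i * u (t - 1 - i))\<bar> \<le> K * \<sigma> ^ m" if "m + L \<le> t" for t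
          using err[of m t] that by simp
        show "s \<in> {m + 2 * L..<m + 3 * L}" "t \<in> {m + 2 * L..<m + 3 * L}"
          using less.prems m by auto
      qed auto
      also have "\<dots> = ((1 - \<epsilon>) * B + 9 * real L * K) * \<sigma> ^ m" by (simp add: algebra_simps)
      also have "\<dots> \<le> ((1 - \<epsilon>) * B + B * (\<epsilon> / 2)) * \<sigma> ^ m"
        using B \<sigma> by (intro mult_right_mono) auto
      also have "\<dots> = B * (1 - \<epsilon> / 2) * \<sigma> ^ m" by (simp add: algebra_simps)
      also have "\<dots> \<le> B * \<sigma> ^ (2 * L) * \<sigma> ^ m"
        using \<sigma>pow \<open>0 \<le> B\<close> \<sigma> by (intro mult_right_mono mult_left_mono) auto
      also have "\<dots> = B * \<sigma> ^ n" by (simp add: m power_add)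
      finally show ?thesis .
    qed
  qed
  have incr: "\<bar>u (n + L) - u (n + L - 1)\<bar> \<le> (B + K) * \<sigma> ^ n" for n
  proof -
    have "(\<Sum>i<L. p i * u (n + L - 1 - i)) - u (n + L - 1)
        = (\<Sum>i<L. p i * (u (n + L - 1 - i) - u (n + L - 1)))"
      by (simp add: right_diff_distrib sum_subtractf sum_distrib_right[symmetric] p)
    also have "\<bar>\<dots>\<bar> \<le> (\<Sum>i<L. p i * (B * \<sigma> ^ n))"
    proof (rule order_trans[OF sum_abs], rule sum_mono)
      fix i assume i: "i \<in> {..<L}"
      then show "\<bar>p i * (u (n + L - 1 - i) - u (n + L - 1))\<bar> \<le> p i * (B * \<sigma> ^ n)"
        using p(1)[of i] osc[of "n + L - 1 - i" n "n + L - 1"] L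
        by (auto simp: abs_mult intro!: mult_left_mono)
    qed
    also have "\<dots> = B * \<sigma> ^ n" by (simp add: sum_distrib_right[symmetric] p)
    finally show ?thesis using err[of n "n + L"] by (simp add: algebra_simps)
  qed
  have "geometrically_small (\<lambda>n. u (Suc n) - u n)"
  proof (rule geometrically_smallI[of \<sigma> L _ "(B + K) / \<sigma> ^ (L - 1)"])
    fix n assume n: "L \<le> n"
    define m where "m = n - (L - 1)"
    have m: "Suc n = m + L" "n = m + L - 1" "n = m + (L - 1)" using n L by (auto simp: m_def)
    have "(B + K) / \<sigma> ^ (L - 1) * \<sigma> ^ n = (B + K) * \<sigma> ^ m" 
      using \<sigma> unfolding m(3) by (simp add: power_add)
    then show "\<bar>u (Suc n) - u n\<bar> \<le> (B + K) / \<sigma> ^ (L - 1) * \<sigma> ^ n"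
      using incr[of m] m(1,2) by simp
  qed (use \<sigma> in auto)
  then show thesis using geometrically_small_increments_converge that by blast
qed

section \<open>Asymptotics of the mean\<close>

text \<open>
  For nonnegative coefficients \<open>q\<close>, the number \<open>1 / x\<close> is the unique positive root of the
  characteristic polynomial \<open>y^L - q\<^sub>0 y^(L - 1) - \<dots>\<close>.
\<close>
lemma reciprocal_dominant_root:
  fixes q :: "nat \<Rightarrow> real"
  assumes "(\<Sum>i<L. q i) > 1"
  obtains x where "0 < x" "x < 1" "(\<Sum>i<L. q i * x ^ Suc i) = 1"
proof -
  define F where "F x = (\<Sum>i<L. q i * x ^ Suc i)" for x
  have "\<exists>x\<ge>0. x \<le> 1 \<and> F x = 1"
  proof (rule IVT')
    show "continuous_on {0..1} F" unfolding F_def by (intro continuous_intros)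
  qed (use assms in \<open>auto simp: F_def\<close>)
  then obtain x where x: "0 \<le> x" "x \<le> 1" "F x = 1" by blast
  have "F 0 \<noteq> 1" "F 1 \<noteq> 1" using assms by (auto simp: F_def)
  then have "x \<noteq> 0" "x \<noteq> 1" using x(3) by auto
  then show thesis using x that[of x] by (simp add: F_def)
qed

text \<open>
  Scaling by \<open>x ^ n\<close>, where \<open>1 / x\<close> is the dominant root, turns both recurrences into averaging ones.
  The one for \<open>a\<close> is exact, so \<open>h n = a n * x ^ n\<close> converges geometrically to some \<open>\<eta>\<close>, which is
  positive because averages never fall below the minimum of the initial values. The one for
  \<open>f n = b n * x ^ n\<close> has an inhomogeneity tending to \<open>\<eta> * (\<Sum>i. v i)\<close>. As a linear sequence of slope
  \<open>\<kappa>\<close> exceeds its weighted average by \<open>\<kappa> * m\<close>, where \<open>m\<close> is the mean delay, the choice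
  \<open>\<kappa> = \<eta> * (\<Sum>i. v i) / m\<close> makes \<open>f n - \<kappa> * n\<close> an averaging sequence up to a geometrically small error.
  Numerator and denominator of the quotient are then known up to such errors.
\<close>
lemma quotient_of_increments_asymptotics:
  fixes q w a b :: "nat \<Rightarrow> real"
  assumes q: "\<And>i. i < L \<Longrightarrow> 0 \<le> q i" "0 < q 0" "0 < q (L - 1)" "1 < (\<Sum>i<L. q i)"
    and w: "\<And>i. i < L \<Longrightarrow> 0 \<le> w i" "\<exists>i<L. 0 < w i"
    and a_pos: "\<And>n. 0 < a n"
    and a_rec: "\<And>n. L \<le> n \<Longrightarrow> a n = (\<Sum>i<L. q i * a (n - 1 - i))"
    and b_rec: "\<And>n. L \<le> n \<Longrightarrow> b n = (\<Sum>i<L. q i * b (n - 1 - i) + w i * a (n - 1 - i))"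
  obtains C d where "0 < C" "eventually (\<lambda>n. a n < a (Suc n)) sequentially"
    "geometrically_small (\<lambda>n. (b (Suc n) - b n) / (a (Suc n) - a n) - (C * real (Suc n) + d))"
proof -
  obtain x where x: "0 < x" "x < 1" "(\<Sum>i<L. q i * x ^ Suc i) = 1"
    using reciprocal_dominant_root[OF q(4)] by blast
  have L: "0 < L" using x(3) by (cases L) auto
  define p where "p i = q i * x ^ Suc i" for i
  have p: "\<And>i. i < L \<Longrightarrow> 0 \<le> p i" "(\<Sum>i<L. p i) = 1" "0 < p 0" "0 < p (L - 1)"
    using q x by (auto simp: p_def)
  define v where "v i = w i * x ^ Suc i" for i
  have v: "0 < (\<Sum>i<L. v i)"
  proof -
    obtain i where "i < L" "0 < w i" using w(2) by blast
    then show ?thesis using w(1) x by (intro sum_pos2[of _ i]) (auto simp: v_def)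
  qed
  define h where "h n = a n * x ^ n" for n
  define f where "f n = b n * x ^ n" for n
  have split_power: "x ^ n = x ^ Suc i * x ^ (n - 1 - i)" if "L \<le> n" "i < L" for n i
    unfolding power_add[symmetric] using that by simp
  have h_rec: "h n = (\<Sum>i<L. p i * h (n - 1 - i))" if "L \<le> n" for n
    unfolding h_def p_def a_rec[OF that] sum_distrib_right
    by (intro sum.cong) (auto simp: split_power[OF that] mult_ac)
  have f_rec: "f n = (\<Sum>i<L. p i * f (n - 1 - i) + v i * h (n - 1 - i))" if "L \<le> n" for n
    unfolding h_def f_def p_def v_def b_rec[OF that] sum_distrib_right
    by (intro sum.cong) (auto simp: split_power[OF that] algebra_simps)
  have "geometrically_small (\<lambda>n. h n - (\<Sum>i<L. p i * h (n - 1 - i)))"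
    by (rule geometrically_small_cong[OF _ geometrically_small_0, of L]) (use h_rec in simp)
  then obtain \<eta> where h_lim: "geometrically_small (\<lambda>n. h n - \<eta>)"
    using averaging_recurrence_converges[OF p] by blast
  have "0 < \<eta>"
  proof -
    define \<delta> where "\<delta> = Min (h ` {..<L})"
    have "0 < \<delta>" unfolding \<delta>_def using L a_pos x by (subst Min_gr_iff) (auto simp: h_def)
    have "\<delta> \<le> h n" for n
    proof -
      have "- h (0 + n) \<le> - \<delta> + real n * 0"
      proof (rule averaging_upper_bound[where u = "\<lambda>n. - h n", OF p(1,2)])
        fix t assume "0 + L \<le> t"
        then show "- h t \<le> (\<Sum>i<L. p i * - h (t - 1 - i)) + 0"
          using h_rec[of t] by (simp add: sum_negf)
      qed (auto simp: \<delta>_def)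
      then show ?thesis by simp
    qed
    moreover have "h \<longlonglongrightarrow> \<eta>" using geometrically_small_tendsto[OF h_lim] LIM_zero_cancel by blast
    ultimately have "\<delta> \<le> \<eta>" by (intro LIMSEQ_le_const) auto
    then show ?thesis using \<open>0 < \<delta>\<close> by simp
  qed
  define m where "m = (\<Sum>i<L. p i * real (Suc i))"
  have "0 < m" unfolding m_def
    by (rule sum_pos2[of _ 0]) (use p L in auto)
  define \<kappa> where "\<kappa> = \<eta> * (\<Sum>i<L. v i) / m"
  have "0 < \<kappa>" using \<open>0 < m\<close> \<open>0 < \<eta>\<close> v by (simp add: \<kappa>_def)
  define g where "g n = f n - \<kappa> * real n" for n
  have g_rec: "g n - (\<Sum>i<L. p i * g (n - 1 - i)) = (\<Sum>i<L. v i * (h (n - 1 - i) - \<eta>))"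
    if n: "L \<le> n" for n
  proof -
    have "(\<Sum>i<L. p i * g (n - 1 - i)) =
        (\<Sum>i<L. p i * f (n - 1 - i) - p i * (\<kappa> * real n) + \<kappa> * (p i * real (Suc i)))"
    proof (intro sum.cong refl)
      fix i assume "i \<in> {..<L}"
      then have *: "real (n - 1 - i) = real n - real (Suc i)" using n by auto
      then show "p i * g (n - 1 - i) =
          p i * f (n - 1 - i) - p i * (\<kappa> * real n) + \<kappa> * (p i * real (Suc i))"
        unfolding g_def * by (simp only: algebra_simps)
    qed
    also have "\<dots> = (\<Sum>i<L. p i * f (n - 1 - i)) - \<kappa> * real n + \<kappa> * m"
      by (simp only: sum.distrib sum_subtractf sum_distrib_right[symmetric]
          sum_distrib_left[symmetric] p m_def mult_1_left)
    also have "\<kappa> * m = (\<Sum>i<L. v i * \<eta>)"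
      unfolding \<kappa>_def sum_distrib_right[symmetric] using \<open>0 < m\<close> by (simp add: mult.commute)
    finally show ?thesis
      using f_rec[OF n] by (simp add: g_def sum.distrib sum_subtractf right_diff_distrib)
  qed
  have "geometrically_small (\<lambda>n. \<Sum>i<L. v i * (h (n - 1 - i) - \<eta>))"
    using geometrically_small_delay[OF h_lim, of "Suc _"]
    by (intro geometrically_small_sum geometrically_small_cmult) simp
  then have "geometrically_small (\<lambda>n. g n - (\<Sum>i<L. p i * g (n - 1 - i)))"
    by (rule geometrically_small_cong[of L, rotated]) (rule g_rec)
  then obtain \<theta> where g_lim: "geometrically_small (\<lambda>n. g n - \<theta>)"
    using averaging_recurrence_converges[OF p] by blast
  define hh where "hh n = (h (Suc n) - \<eta>) - x * (h n - \<eta>)" for n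
  define gg where "gg n = (g (Suc n) - \<theta>) - x * (g n - \<theta>)" for n
  have hh: "geometrically_small hh" and gg: "geometrically_small gg"
    unfolding hh_def[abs_def] gg_def[abs_def]
    using geometrically_small_diff[OF geometrically_small_Suc[OF h_lim] geometrically_small_cmult[OF h_lim]]
      geometrically_small_diff[OF geometrically_small_Suc[OF g_lim] geometrically_small_cmult[OF g_lim]]
    by simp_all
  define den where "den n = (1 - x) * \<eta> + hh n" for n
  \<comment> \<open>These constants make \<open>(C * (n + 1) + d) * ((1 - x) * \<eta>)\<close> equal to the main part of the numerator.\<close>
  define C where "C = \<kappa> / \<eta>"
  define d where "d = (x * \<kappa> + (1 - x) * \<theta>) / ((1 - x) * \<eta>)"
  have den_lim: "den \<longlonglongrightarrow> (1 - x) * \<eta>"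
    using tendsto_add[OF tendsto_const geometrically_small_tendsto[OF hh]] by (simp add: den_def[abs_def])
  have lim_pos: "0 < (1 - x) * \<eta>" using x \<open>0 < \<eta>\<close> by simp
  have den_pos: "eventually (\<lambda>n. 0 < den n) sequentially"
    using order_tendstoD(1)[OF den_lim lim_pos] .
  have den_eq: "a (Suc n) - a n = den n / x ^ Suc n" for n
    using x by (simp add: den_def hh_def h_def field_simps)
  have num_eq: "b (Suc n) - b n =
      ((1 - x) * \<kappa> * real (Suc n) + x * \<kappa> + (1 - x) * \<theta> + gg n) / x ^ Suc n" for n
    using x by (simp add: gg_def g_def f_def field_simps)
  have quot: "(b (Suc n) - b n) / (a (Suc n) - a n) - (C * real (Suc n) + d)
      = inverse (den n) * (gg n - (C * (real n * hh n) + (C + d) * hh n))" if "0 < den n" for n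
  proof -
    have "(b (Suc n) - b n) / (a (Suc n) - a n)
        = ((1 - x) * \<kappa> * real (Suc n) + x * \<kappa> + (1 - x) * \<theta> + gg n) / den n"
      unfolding den_eq num_eq using x by simp
    moreover have "(1 - x) * \<kappa> * real (Suc n) + x * \<kappa> + (1 - x) * \<theta> 
        = (C * real (Suc n) + d) * ((1 - x) * \<eta>)"
    proof -
      have "C * \<eta> = \<kappa>" "d * ((1 - x) * \<eta>) = x * \<kappa> + (1 - x) * \<theta>"
        using lim_pos \<open>0 < \<eta>\<close> by (auto simp: C_def d_def)
      then show ?thesis by (auto simp: algebra_simps)
    qed
    ultimately have "(b (Suc n) - b n) / (a (Suc n) - a n)
        = ((C * real (Suc n) + d) * (den n - hh n) + gg n) / den n"
      by (simp add: den_def)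
    then show ?thesis using that by (simp add: field_simps)
  qed
  obtain n0 where n0: "\<And>n. n0 \<le> n \<Longrightarrow> 0 < den n"
    using den_pos by (auto simp: eventually_sequentially)
  have "(\<lambda>n. inverse (den n)) \<in> O(\<lambda>_. 1)"
    using tendsto_inverse[OF den_lim less_imp_neq[OF lim_pos, symmetric]]
    by (intro bigoI_tendsto[where c = "inverse ((1 - x) * \<eta>)"]) simp_all
  then have "geometrically_small
      (\<lambda>n. inverse (den n) * (gg n - (C * (real n * hh n) + (C + d) * hh n)))"
    by (rule geometrically_small_bigo_mult[OF _ geometrically_small_diff[OF gg
          geometrically_small_add[OF geometrically_small_cmult[OF geometrically_small_linear_mult[OF hh]]
            geometrically_small_cmult[OF hh]]]])
  then have "geometrically_small
      (\<lambda>n. (b (Suc n) - b n) / (a (Suc n) - a n) - (C * real (Suc n) + d))"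
    by (rule geometrically_small_cong[of n0, rotated]) (rule quot[OF n0])
  moreover have "eventually (\<lambda>n. a n < a (Suc n)) sequentially"
    using den_pos
  proof eventually_elim
    case (elim n)
    then have "0 < den n / x ^ Suc n" using x by simp
    then show ?case using den_eq[of n] by linarith
  qed
  ultimately show thesis using that[of C d] \<open>0 < \<kappa>\<close> \<open>0 < \<eta>\<close> by (simp add: C_def)
qed

theorem theorem1p2:
  fixes c :: "nat list"
  shows "\<exists>C d \<gamma> :: real. C > 0 \<and> 0 < \<gamma> \<and> \<gamma> < 1 \<and>
           (\<forall>H. PLRS c H \<longrightarrow>
              (\<lambda>n. mean_summands c H n - (C * real n + d)) \<in> o(\<lambda>n. \<gamma> ^ n))"
proof (cases "plrs_coeffs c")
  case False
  then have "\<not> PLRS c H" for H by (simp add: PLRS_def)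
  then show ?thesis by (intro exI[of _ 1] exI[of _ 0] exI[of _ "1/2"]) simp
next
  case True
  then have c: "c \<noteq> []" "0 < c ! 0" "0 < c ! (length c - 1)" by (auto simp: plrs_coeffs_def)
  let ?a = "\<lambda>n. real (num_words c c n)" and ?b = "\<lambda>n. real (total_digit_sum c c n)"
  obtain C d where Cd: "0 < C" "eventually (\<lambda>n. ?a n < ?a (Suc n)) sequentially"
    "geometrically_small (\<lambda>n. (?b (Suc n) - ?b n) / (?a (Suc n) - ?a n) - (C * real (Suc n) + d))"
  proof (rule quotient_of_increments_asymptotics[where L = "length c" and a = ?a and b = ?b
        and q = "\<lambda>i. real (c ! i)" and w = "\<lambda>i. real (block_weight c i)"])
    show "1 < (\<Sum>i<length c. real (c ! i))"
      using plrs_coeffs_sum_gt_1[OF True] by (simp add: of_nat_sum[symmetric] del: of_nat_sum)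
    show "\<exists>i<length c. 0 < real (block_weight c i)"
      using block_weight_pos[OF True] c by (intro exI[of _ "length c - 1"]) auto
    show "?a n = (\<Sum>i<length c. real (c ! i) * ?a (n - 1 - i))" if "length c \<le> n" for n
      using num_words_unfold[of c c n] that by (simp add: min_def)
    show "?b n = (\<Sum>i<length c. real (c ! i) * ?b (n - 1 - i) + real (block_weight c i) * ?a (n - 1 - i))"
      if "length c \<le> n" for n
      using total_digit_sum_unfold[OF that, of c] by simp
  qed (use c num_words_pos in auto)
  define s where "s n = (?b (Suc n) - ?b n) / (?a (Suc n) - ?a n) - (C * real (Suc n) + d)" for n
  have "geometrically_small (\<lambda>n. s (n - 1))"
    using geometrically_small_delay[of s 1] Cd(3) unfolding s_def[abs_def] .
  then obtain \<gamma> where \<gamma>: "0 < \<gamma>" "\<gamma> < 1" "(\<lambda>n. s (n - 1)) \<in> o(\<lambda>n. \<gamma> ^ n)"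
    by (rule geometrically_small_smallo)
  have "(\<lambda>n. mean_summands c H n - (C * real n + d)) \<in> o(\<lambda>n. \<gamma> ^ n)" if "PLRS c H" for H
  proof -
    have "eventually (\<lambda>n. mean_summands c H (Suc n) - (C * real (Suc n) + d) = s n) sequentially"
      using Cd(2)
    proof eventually_elim
      case (elim n)
      then show ?case using mean_summands_eq[OF that, of n] by (simp add: s_def)
    qed
    then have "eventually (\<lambda>n. mean_summands c H n - (C * real n + d) = s (n - 1)) sequentially"
      by (subst eventually_sequentially_Suc[symmetric]) simp
    from landau_o.small.in_cong[OF this] show ?thesis using \<gamma>(3) by simp
  qed
  then show ?thesis using Cd(1) \<gamma> by blast
qed

end
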